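(* Let $N=\{1,\dots,n\}$, let $(\bm{x}_i,y_i)\in\mathbb{R}^d\times\{-1,1\}$ for $i\in N$, let $C>0$, let $0\le\lambda_1\le\cdots\le\lambda_n$, and let $K(\bm{x},\bm{x}')=\phi(\bm{x})\cdot\phi(\bm{x}')$ be a kernel function with feature map $\phi$. Let $(\bm{\alpha}^*,\bm{\eta}^* )$ be an optimal solution of (C-OWA-SVM$_K$), and let $k\in N$ satisfy $$0<\alpha_k^*<C\sum_{j=1}^n\eta_{kj}^*\lambda_j.$$ Then the coefficient $b$ of the separator function $\bm{x}\mapsto\sum_{i=1}^n\alpha_i^*y_iK(\bm{x}_i,\bm{x})+b$ associated with (C-OWA-SVM$_K$) is given by $$b=\frac{1-y_k\left(\sum_{i=1}^n\alpha_i^*y_iK(\bm{x}_i,\bm{x}_k)\right)}{y_k}.$$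
   Context: $\phi$ maps the observations from $\mathbb{R}^d$ into a (higher-dimensional) real inner product space, with scalar product denoted by $\cdot$. The problem (C-OWA-SVM$_K$) is $$\max_{\bm{\alpha},\bm{\eta}}\ \sum_{i=1}^n\alpha_i-\frac12\sum_{i=1}^n\sum_{j=1}^n\alpha_i\alpha_jy_iy_jK(\bm{x}_i,\bm{x}_j)$$ subject to $\sum_{i=1}^n\alpha_iy_i=0$; $\alpha_i\le\sum_{j=1}^n\eta_{ij}C\lambda_j$ for $i\in N$; $\sum_{i=1}^n\eta_{ij}=1$ for $j\in N$; $\sum_{j=1}^n\eta_{ij}=1$ for $i\in N$; $\alpha_i\ge0$ for $i\in N$; $\eta_{ij}\ge0$ for $i,j\in N$. It is the dual of the following primal problem, (C-OWA-SVM) with each $\bm{x}_i$ replaced by $\phi(\bm{x}_i)$: $$\min_{\bm{w}_\phi,b,\bm{\xi},\bm{u},\bm{v}}\ \frac12\|\bm{w}_\phi\|^2+\sum_{i=1}^nu_i+\sum_{j=1}^nv_j$$ subject to $y_i(\bm{w}_\phi\cdot\phi(\bm{x}_i)+b)\ge1-\xi_i$ and $\xi_i\ge0$ for $i\in N$; $u_i+v_j\ge C\lambda_j\xi_i$ for $i,j\in N$; $\bm{w}_\phi$ in the feature space, $b\in\mathbb{R}$, $u_i,v_j\in\mathbb{R}$. The separator function is $\bm{x}\mapsto\bm{w}_\phi\cdot\phi(\bm{x})+b=\sum_{i=1}^n\alpha_i^*y_iK(\bm{x}_i,\bm{x})+b$, where the coefficient $b$ is the value of the variable $b$ in an optimal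 solution of this primal problem. *)

theory Defs
  imports "HOL-Analysis.Analysis"
begin

text \<open>
  Observations, labels and weights are indexed by the naturals in \<open>{1..n}\<close>; values of the
  index functions outside this range occur in no constraint and no objective.
\<close>

definition dual_objective ::
  "nat \<Rightarrow> (nat \<Rightarrow> 'a) \<Rightarrow> (nat \<Rightarrow> real) \<Rightarrow> ('a \<Rightarrow> 'a \<Rightarrow> real) \<Rightarrow> (nat \<Rightarrow> real) \<Rightarrow> real" where
  "dual_objective n x y K \<alpha> =
     (\<Sum>i=1..n. \<alpha> i) - 1/2 * (\<Sum>i=1..n. \<Sum>j=1..n. \<alpha> i * \<alpha> j * y i * y j * K (x i) (x j))"

definition dual_feasible ::
  "nat \<Rightarrow> (nat \<Rightarrow> real) \<Rightarrow> real \<Rightarrow> (nat \<Rightarrow> real) \<Rightarrow> (nat \<Rightarrow> real) \<Rightarrow> (nat \<Rightarrow> nat \<Rightarrow> real) \<Rightarrow> bool" where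
  "dual_feasible n y C lam \<alpha> \<eta> \<longleftrightarrow>
     (\<Sum>i=1..n. \<alpha> i * y i) = 0 \<and>
     (\<forall>i\<in>{1..n}. \<alpha> i \<le> (\<Sum>j=1..n. \<eta> i j * C * lam j)) \<and>
     (\<forall>j\<in>{1..n}. (\<Sum>i=1..n. \<eta> i j) = 1) \<and>
     (\<forall>i\<in>{1..n}. (\<Sum>j=1..n. \<eta> i j) = 1) \<and>
     (\<forall>i\<in>{1..n}. \<alpha> i \<ge> 0) \<and>
     (\<forall>i\<in>{1..n}. \<forall>j\<in>{1..n}. \<eta> i j \<ge> 0)"

definition dual_optimal ::
  "nat \<Rightarrow> (nat \<Rightarrow> 'a) \<Rightarrow> (nat \<Rightarrow> real) \<Rightarrow> real \<Rightarrow> (nat \<Rightarrow> real) \<Rightarrow> ('a \<Rightarrow> 'a \<Rightarrow> real) \<Rightarrow>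
   (nat \<Rightarrow> real) \<Rightarrow> (nat \<Rightarrow> nat \<Rightarrow> real) \<Rightarrow> bool" where
  "dual_optimal n x y C lam K \<alpha> \<eta> \<longleftrightarrow>
     is_arg_max (\<lambda>(\<alpha>, \<eta>). dual_objective n x y K \<alpha>)
                (\<lambda>(\<alpha>, \<eta>). dual_feasible n y C lam \<alpha> \<eta>) (\<alpha>, \<eta>)"

definition primal_objective ::
  "nat \<Rightarrow> 'h::real_inner \<Rightarrow> (nat \<Rightarrow> real) \<Rightarrow> (nat \<Rightarrow> real) \<Rightarrow> real" where
  "primal_objective n w u v = 1/2 * (norm w)\<^sup>2 + (\<Sum>i=1..n. u i) + (\<Sum>j=1..n. v j)"

definition primal_feasible ::
  "nat \<Rightarrow> (nat \<Rightarrow> 'a) \<Rightarrow> (nat \<Rightarrow> real) \<Rightarrow> real \<Rightarrow> (nat \<Rightarrow> real) \<Rightarrow> ('a \<Rightarrow> 'h::real_inner) \<Rightarrow>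
   'h \<Rightarrow> real \<Rightarrow> (nat \<Rightarrow> real) \<Rightarrow> (nat \<Rightarrow> real) \<Rightarrow> (nat \<Rightarrow> real) \<Rightarrow> bool" where
  "primal_feasible n x y C lam \<phi> w b \<xi> u v \<longleftrightarrow>
     (\<forall>i\<in>{1..n}. y i * (w \<bullet> \<phi> (x i) + b) \<ge> 1 - \<xi> i) \<and>
     (\<forall>i\<in>{1..n}. \<xi> i \<ge> 0) \<and>
     (\<forall>i\<in>{1..n}. \<forall>j\<in>{1..n}. u i + v j \<ge> C * lam j * \<xi> i)"

definition primal_optimal ::
  "nat \<Rightarrow> (nat \<Rightarrow> 'a) \<Rightarrow> (nat \<Rightarrow> real) \<Rightarrow> real \<Rightarrow> (nat \<Rightarrow> real) \<Rightarrow> ('a \<Rightarrow> 'h::real_inner) \<Rightarrow>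
   'h \<Rightarrow> real \<Rightarrow> (nat \<Rightarrow> real) \<Rightarrow> (nat \<Rightarrow> real) \<Rightarrow> (nat \<Rightarrow> real) \<Rightarrow> bool" where
  "primal_optimal n x y C lam \<phi> w b \<xi> u v \<longleftrightarrow>
     is_arg_min (\<lambda>(w, b, \<xi>, u, v). primal_objective n w u v)
                (\<lambda>(w, b, \<xi>, u, v). primal_feasible n x y C lam \<phi> w b \<xi> u v) (w, b, \<xi>, u, v)"

text \<open>
  \<open>f\<close> is a separator function belonging to the dual solution \<open>\<alpha>\<close>, with coefficient \<open>b\<close>.
  The coefficient is a component of an optimal solution of the primal problem, which is
  not tied to \<open>\<alpha>\<close> in any other way.
\<close>

definition separator_function ::
  "nat \<Rightarrow> (nat \<Rightarrow> 'a) \<Rightarrow> (nat \<Rightarrow> real) \<Rightarrow> real \<Rightarrow> (nat \<Rightarrow> real) \<Rightarrow> ('a \<Rightarrow> 'h::real_inner) \<Rightarrow>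
   ('a \<Rightarrow> 'a \<Rightarrow> real) \<Rightarrow> (nat \<Rightarrow> real) \<Rightarrow> ('a \<Rightarrow> real) \<Rightarrow> real \<Rightarrow> bool" where
  "separator_function n x y C lam \<phi> K \<alpha> f b \<longleftrightarrow>
     f = (\<lambda>z. (\<Sum>i=1..n. \<alpha> i * y i * K (x i) z) + b) \<and>
     (\<exists>w \<xi> u v. primal_optimal n x y C lam \<phi> w b \<xi> u v)"

end

theory Submission
  imports Defs
begin

text \<open>
  The formula for \<open>b\<close> says that observation \<open>k\<close> lies exactly on its margin,
  \<open>y k * (w \<bullet> \<phi> (x k) + b) = 1\<close>, for the primal solution \<open>w\<close>, and that \<open>w\<close> has the kernel
  expansion with coefficients \<open>\<alpha> i * y i\<close>. Both are optimality conditions linking a dual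
  and a primal solution; as these are given independently of each other, the conditions hold only because
  the two optimal values coincide.

  The difference of the two objectives is an explicit sum of nonnegative terms
  (\<open>duality_gap\<close>): the squared distance of \<open>w\<close> from \<open>\<Sum>i. \<alpha> i * y i * \<phi> (x i)\<close> and the products of
  each multiplier with the slack of its constraint. When the gap closes, every one of these
  terms vanishes (\<open>complementary_slackness\<close>). At the index \<open>k\<close> the strict upper bound on
  \<open>\<alpha> k\<close> then forces \<open>\<xi> k = 0\<close>, and \<open>\<alpha> k > 0\<close> turns the margin constraint into an equation.

  That the gap closes is \<open>strong_duality\<close>. The dual objective is a concave quadratic, so a dual
  solution also maximizes its own linearization over the dual polytope
  (\<open>dual_optimal_linearized\<close>). This is a linear program in finitely many variables, whatever
  the dimension of the feature space, and Farkas' lemma yields its multipliers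
  (\<open>linear_program_multipliers\<close>). The multipliers, together with the weight vector of \<open>\<alpha>\<close>, form
  a primal feasible point, and their complementarity makes its gap zero. The objective of
  a primal solution is at most that of this point, so its gap is zero as well.
\<close>

section \<open>Linear programming: Farkas' lemma and multipliers\<close>

text \<open>
  Points are functions on an arbitrary index type of variables, so that programs whose number of
  variables is not fixed by a type can be treated; linearity is therefore spelled out pointwise.
\<close>

definition linear_form :: "(('v \<Rightarrow> real) \<Rightarrow> real) \<Rightarrow> bool" where
  "linear_form f \<longleftrightarrow> (\<forall>v w s. f (\<lambda>j. v j + s * w j) = f v + s * f w)"

lemma linear_form_add_scaled:
  "linear_form f \<Longrightarrow> f (\<lambda>j. v j + s * w j) = f v + s * f w"
  by (simp add: linear_form_def)

lemma linear_form_zero: "linear_form f \<Longrightarrow> f (\<lambda>j. 0) = 0"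
  using linear_form_add_scaled[of f "\<lambda>j. 0" 1 "\<lambda>j. 0"] by simp

lemma linear_form_scaled: "linear_form f \<Longrightarrow> f (\<lambda>j. s * v j) = s * f v"
  using linear_form_add_scaled[of f "\<lambda>j. 0" s v] linear_form_zero[of f] by simp

text \<open>
  The induction on the number of forms eliminates one form at a time.
  If the form \<open>f k\<close> cannot be dropped, then some \<open>p\<close> satisfies all other inequalities
  although \<open>g p > 0\<close>. Projecting along \<open>p\<close> onto the kernel of \<open>f k\<close> makes \<open>f k\<close> disappear, and the
  representation of the projected \<open>g\<close> determines the missing coefficient, whose sign is
  given by the choice of \<open>p\<close>.
\<close>

lemma farkas:
  assumes "finite I" "\<And>i. i \<in> I \<Longrightarrow> linear_form (f i)" "linear_form g"
    and "\<And>v. (\<And>i. i \<in> I \<Longrightarrow> f i v \<le> 0) \<Longrightarrow> g v \<le> 0"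
  shows "\<exists>c. (\<forall>i\<in>I. 0 \<le> c i) \<and> (\<forall>v. g v = (\<Sum>i\<in>I. c i * f i v))"
  using assms
proof (induction I arbitrary: f g rule: finite_induct)
  case empty
  have "g v = 0" for v
    using empty.prems(3)[of v] empty.prems(3)[of "\<lambda>j. (-1) * v j"]
      linear_form_scaled[OF empty.prems(2), of "-1" v] by simp
  then show ?case by simp
next
  case (insert k I)
  show ?case
  proof (cases "\<forall>v. (\<forall>i\<in>I. f i v \<le> 0) \<longrightarrow> g v \<le> 0")
    case True
    then obtain c where c: "\<forall>i\<in>I. 0 \<le> c i" "\<forall>v. g v = (\<Sum>i\<in>I. c i * f i v)"
      using insert.IH[of f g] insert.prems by auto
    have "(\<Sum>i\<in>I. (c(k := 0)) i * f i v) = (\<Sum>i\<in>I. c i * f i v)" for v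
      using insert.hyps by (intro sum.cong) auto
    then show ?thesis
      using c insert.hyps by (intro exI[of _ "c(k := 0)"]) auto
  next
    case False
    then obtain p where p: "\<And>i. i \<in> I \<Longrightarrow> f i p \<le> 0" "g p > 0" by force
    have fk: "f k p > 0"
    proof (rule ccontr)
      assume "\<not> f k p > 0"
      then have "g p \<le> 0" using p(1) by (intro insert.prems(3)) auto
      then show False using p(2) by simp
    qed
    \<comment> \<open>\<open>r\<close> projects along \<open>p\<close> onto the kernel of \<open>f k\<close>.\<close>
    define r where "r v j = v j + (- (f k v / f k p)) * p j" for v j
    have at_r: "h (r v) = h v - f k v / f k p * h p" if "linear_form h" for h v
      unfolding r_def by (simp only: linear_form_add_scaled[OF that])
    have lin_r: "linear_form (\<lambda>v. h (r v))" if h: "linear_form h" for h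
      unfolding linear_form_def
    proof (intro allI)
      fix v w s
      show "h (r (\<lambda>j. v j + s * w j)) = h (r v) + s * h (r w)"
        using insert.prems(1)[of k] h
        by (simp add: at_r linear_form_add_scaled add_divide_distrib algebra_simps)
    qed
    have kr: "f k (r v) = 0" for v
      using insert.prems(1)[of k] fk by (simp add: at_r)
    have "\<exists>c. (\<forall>i\<in>I. 0 \<le> c i) \<and> (\<forall>v. g (r v) = (\<Sum>i\<in>I. c i * f i (r v)))"
    proof (rule insert.IH)
      fix v assume "\<And>i. i \<in> I \<Longrightarrow> f i (r v) \<le> 0"
      then show "g (r v) \<le> 0" using kr[of v] by (intro insert.prems(3)) auto
    qed (use insert.prems in \<open>auto intro: lin_r\<close>)
    then obtain c where c: "\<forall>i\<in>I. 0 \<le> c i" "\<And>v. g (r v) = (\<Sum>i\<in>I. c i * f i (r v))" by blast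
    define e where "e = (g p - (\<Sum>i\<in>I. c i * f i p)) / f k p"
    have "(\<Sum>i\<in>I. c i * f i p) \<le> 0"
      using c(1) p(1) by (intro sum_nonpos) (simp add: mult_nonneg_nonpos)
    then have e0: "0 \<le> e" using p(2) fk by (simp add: e_def)
    have "g v = e * f k v + (\<Sum>i\<in>I. c i * f i v)" for v
    proof -
      have "g v - f k v / f k p * g p = (\<Sum>i\<in>I. c i * (f i v - f k v / f k p * f i p))"
        using c(2)[of v] insert.prems(1,2) by (simp add: at_r)
      also have "\<dots> = (\<Sum>i\<in>I. c i * f i v) - f k v / f k p * (\<Sum>i\<in>I. c i * f i p)"
        by (simp add: right_diff_distrib sum_subtractf sum_distrib_left mult.left_commute)
      finally show ?thesis
        unfolding e_def by (simp add: algebra_simps diff_divide_distrib)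
    qed
    moreover have "(\<Sum>i\<in>I. (c(k := e)) i * f i v) = (\<Sum>i\<in>I. c i * f i v)" for v
      using insert.hyps by (intro sum.cong) auto
    ultimately show ?thesis
      using c(1) e0 insert.hyps by (intro exI[of _ "c(k := e)"]) auto
  qed
qed

text \<open>
  An equation is a pair of opposite inequalities; the difference of their two nonnegative
  coefficients is a coefficient of arbitrary sign.
\<close>

lemma farkas_with_equations:
  assumes fin: "finite I" "finite E"
    and lin: "\<And>i. i \<in> I \<Longrightarrow> linear_form (f i)" "\<And>e. e \<in> E \<Longrightarrow> linear_form (h e)" "linear_form g"
    and imp: "\<And>v. \<lbrakk>\<And>i. i \<in> I \<Longrightarrow> f i v \<le> 0; \<And>e. e \<in> E \<Longrightarrow> h e v = 0\<rbrakk> \<Longrightarrow> g v \<le> 0"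
  shows "\<exists>c d. (\<forall>i\<in>I. 0 \<le> c i) \<and> (\<forall>v. g v = (\<Sum>i\<in>I. c i * f i v) + (\<Sum>e\<in>E. d e * h e v))"
proof -
  define F where "F = case_sum f (case_sum h (\<lambda>e v. - h e v))"
  have "\<exists>c. (\<forall>i\<in>I <+> (E <+> E). 0 \<le> c i) \<and> (\<forall>v. g v = (\<Sum>i\<in>I <+> (E <+> E). c i * F i v))"
  proof (rule farkas)
    show "linear_form (F i)" if "i \<in> I <+> (E <+> E)" for i
      using that lin by (auto simp: F_def linear_form_def)
    fix v assume *: "\<And>i. i \<in> I <+> (E <+> E) \<Longrightarrow> F i v \<le> 0"
    show "g v \<le> 0"
    proof (rule imp)
      show "f i v \<le> 0" if "i \<in> I" for i using *[OF InlI[OF that]] by (simp add: F_def)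
      show "h e v = 0" if "e \<in> E" for e
        using *[OF InrI[OF InlI[OF that]]] *[OF InrI[OF InrI[OF that]]] by (simp add: F_def)
    qed
  qed (use fin lin in auto)
  then obtain c where c: "\<forall>i\<in>I <+> (E <+> E). 0 \<le> c i"
      "\<And>v. g v = (\<Sum>i\<in>I <+> (E <+> E). c i * F i v)" by blast
  have "g v = (\<Sum>i\<in>I. c (Inl i) * f i v)
      + (\<Sum>e\<in>E. (c (Inr (Inl e)) - c (Inr (Inr e))) * h e v)" for v
    using fin by (simp add: c(2) sum.Plus F_def left_diff_distrib sum_subtractf sum_negf)
  moreover have "\<forall>i\<in>I. 0 \<le> c (Inl i)" using c(1) by auto
  ultimately show ?thesis
    by (intro exI[of _ "\<lambda>i. c (Inl i)"] exI[of _ "\<lambda>e. c (Inr (Inl e)) - c (Inr (Inr e))"]) simp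
qed

text \<open>
  Karush-Kuhn-Tucker conditions for a linear program. Only the constraints that are tight at
  \<open>z\<close> restrict a small step away from \<open>z\<close>, so Farkas' lemma is applied to them alone. The
  other constraints get multiplier 0, which is complementary slackness.
\<close>

lemma linear_program_multipliers:
  assumes fin: "finite I" "finite E"
    and lin: "\<And>i. i \<in> I \<Longrightarrow> linear_form (f i)" "\<And>e. e \<in> E \<Longrightarrow> linear_form (h e)" "linear_form g"
    and z: "\<And>i. i \<in> I \<Longrightarrow> f i z \<le> \<beta> i" "\<And>e. e \<in> E \<Longrightarrow> h e z = \<gamma> e"
    and max: "\<And>v. \<lbrakk>\<And>i. i \<in> I \<Longrightarrow> f i v \<le> \<beta> i; \<And>e. e \<in> E \<Longrightarrow> h e v = \<gamma> e\<rbrakk> \<Longrightarrow> g v \<le> g z"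
  obtains c d where "\<And>i. i \<in> I \<Longrightarrow> 0 \<le> c i" "\<And>i. i \<in> I \<Longrightarrow> c i * (\<beta> i - f i z) = 0"
    "\<And>v. g v = (\<Sum>i\<in>I. c i * f i v) + (\<Sum>e\<in>E. d e * h e v)"
proof -
  \<comment> \<open>the tight constraints\<close>
  define A where "A = {i \<in> I. f i z = \<beta> i}"
  have "\<exists>c d. (\<forall>i\<in>A. 0 \<le> c i) \<and> (\<forall>v. g v = (\<Sum>i\<in>A. c i * f i v) + (\<Sum>e\<in>E. d e * h e v))"
  proof (rule farkas_with_equations)
    fix v assume v: "\<And>i. i \<in> A \<Longrightarrow> f i v \<le> 0" "\<And>e. e \<in> E \<Longrightarrow> h e v = 0"
    \<comment> \<open>A direction allowed by the tight constraints can be followed for a positive time.\<close>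
    have "eventually (\<lambda>t. f i z + t * f i v \<le> \<beta> i) (at_right 0)" if i: "i \<in> I" for i
    proof (cases "i \<in> A")
      case True
      have "f i z + t * f i v \<le> \<beta> i" if "t > 0" for t
        using v(1)[OF True] True that by (simp add: A_def mult_pos_neg mult_nonneg_nonpos)
      then show ?thesis by (auto intro: eventually_at_rightI[of 0 1])
    next
      case False
      then have "f i z + 0 * f i v < \<beta> i" using z(1)[OF i] i by (auto simp: A_def)
      moreover have "((\<lambda>t. f i z + t * f i v) \<longlongrightarrow> f i z + 0 * f i v) (at_right 0)"
        by (intro tendsto_intros)
      ultimately have "eventually (\<lambda>t. f i z + t * f i v < \<beta> i) (at_right 0)"
        by (rule order_tendstoD(2)[rotated])
      then show ?thesis by (rule eventually_mono) simp
    qed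
    then have "eventually (\<lambda>t. \<forall>i\<in>I. f i z + t * f i v \<le> \<beta> i) (at_right 0)"
      using fin(1) by (simp add: eventually_ball_finite)
    moreover have "eventually (\<lambda>t. t > (0::real)) (at_right 0)"
      by (rule eventually_at_right_less)
    ultimately have "eventually (\<lambda>t. t > 0 \<and> (\<forall>i\<in>I. f i z + t * f i v \<le> \<beta> i)) (at_right 0)"
      by eventually_elim simp
    then obtain t where t: "t > 0" "\<forall>i\<in>I. f i z + t * f i v \<le> \<beta> i"
      using eventually_happens[of _ "at_right (0::real)"] by (auto simp: trivial_limit_at_right_real)
    have "g (\<lambda>j. z j + t * v j) \<le> g z"
      using t z v lin by (intro max) (auto simp: linear_form_add_scaled)
    then show "g v \<le> 0"
      using t(1) lin(3) by (simp add: linear_form_add_scaled mult_le_0_iff)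
  qed (use fin lin in \<open>auto simp: A_def\<close>)
  then obtain c d where cd: "\<forall>i\<in>A. 0 \<le> c i"
      "\<And>v. g v = (\<Sum>i\<in>A. c i * f i v) + (\<Sum>e\<in>E. d e * h e v)" by blast
  show ?thesis
  proof (rule that[of "\<lambda>i. if f i z = \<beta> i then c i else 0" d])
    fix v
    have "(\<Sum>i\<in>A. c i * f i v) = (\<Sum>i\<in>I. (if f i z = \<beta> i then c i else 0) * f i v)"
      unfolding A_def using fin(1) by (simp add: sum.inter_filter if_distrib[of "\<lambda>a. a * _"] cong: if_cong)
    then show "g v = (\<Sum>i\<in>I. (if f i z = \<beta> i then c i else 0) * f i v) + (\<Sum>e\<in>E. d e * h e v)"
      using cd(2)[of v] by simp
  qed (use cd(1) in \<open>auto simp: A_def\<close>)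
qed

section \<open>The duality gap\<close>

definition dual_weight ::
  "nat \<Rightarrow> (nat \<Rightarrow> 'a) \<Rightarrow> (nat \<Rightarrow> real) \<Rightarrow> ('a \<Rightarrow> 'h::real_inner) \<Rightarrow> (nat \<Rightarrow> real) \<Rightarrow> 'h" where
  "dual_weight n x y \<phi> \<alpha> = (\<Sum>i=1..n. (\<alpha> i * y i) *\<^sub>R \<phi> (x i))"

lemma inner_dual_weight:
  "w \<bullet> dual_weight n x y \<phi> \<alpha> = (\<Sum>i=1..n. \<alpha> i * y i * (w \<bullet> \<phi> (x i)))"
  by (simp add: dual_weight_def inner_sum_right)

lemma dual_objective_eq:
  assumes "\<forall>z z'. K z z' = \<phi> z \<bullet> \<phi> z'"
  shows "dual_objective n x y K \<alpha> =
    (\<Sum>i=1..n. \<alpha> i) - 1/2 * (dual_weight n x y \<phi> \<alpha> \<bullet> dual_weight n x y \<phi> \<alpha>)"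
proof -
  have "dual_weight n x y \<phi> \<alpha> \<bullet> dual_weight n x y \<phi> \<alpha> =
      (\<Sum>i=1..n. \<Sum>j=1..n. \<alpha> i * \<alpha> j * y i * y j * K (x i) (x j))"
    unfolding dual_weight_def inner_sum_left inner_sum_right
    by (simp add: assms mult_ac inner_commute)
  then show ?thesis by (simp add: dual_objective_def)
qed

text \<open>
  The gap between the objectives, as an exact identity. It is bilinear bookkeeping: the row and
  column sums of \<open>\<eta>\<close> rewrite \<open>\<Sum>i. u i\<close> and \<open>\<Sum>j. v j\<close> as double sums, and the balance equation
  \<open>\<Sum>i. \<alpha> i * y i = 0\<close> removes \<open>b\<close>. An identity, rather than the inequality of weak duality,
  serves in both directions: to show that the gap of a point is zero, and to read off
  what a zero gap implies.
\<close>

lemma duality_gap: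
  assumes K: "\<forall>z z'. K z z' = \<phi> z \<bullet> \<phi> z'"
    and feas: "dual_feasible n y C lam \<alpha> \<eta>"
  shows "primal_objective n w u v - dual_objective n x y K \<alpha> =
      1/2 * (norm (w - dual_weight n x y \<phi> \<alpha>))\<^sup>2
    + (\<Sum>i=1..n. \<alpha> i * (y i * (w \<bullet> \<phi> (x i) + b) - 1 + \<xi> i))
    + (\<Sum>i=1..n. \<xi> i * ((\<Sum>j=1..n. \<eta> i j * C * lam j) - \<alpha> i))
    + (\<Sum>i=1..n. \<Sum>j=1..n. \<eta> i j * (u i + v j - C * lam j * \<xi> i))"
proof -
  let ?W = "dual_weight n x y \<phi> \<alpha>"
  have "(\<Sum>i=1..n. \<Sum>j=1..n. \<eta> i j * u i) = (\<Sum>i=1..n. u i)"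
    using feas by (simp add: dual_feasible_def flip: sum_distrib_right)
  moreover have "(\<Sum>i=1..n. \<Sum>j=1..n. \<eta> i j * v j) = (\<Sum>j=1..n. v j)"
    using feas by (subst sum.swap) (simp add: dual_feasible_def flip: sum_distrib_right)
  moreover have "(\<Sum>i=1..n. \<xi> i * (\<Sum>j=1..n. \<eta> i j * C * lam j)) =
      (\<Sum>i=1..n. \<Sum>j=1..n. \<eta> i j * (C * lam j * \<xi> i))"
    by (simp add: sum_distrib_left mult_ac)
  moreover have "(\<Sum>i=1..n. \<Sum>j=1..n. \<eta> i j * (u i + v j - C * lam j * \<xi> i)) =
      (\<Sum>i=1..n. \<Sum>j=1..n. \<eta> i j * u i) + (\<Sum>i=1..n. \<Sum>j=1..n. \<eta> i j * v j)
      - (\<Sum>i=1..n. \<Sum>j=1..n. \<eta> i j * (C * lam j * \<xi> i))"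
    by (simp add: ring_distribs sum.distrib sum_subtractf)
  moreover have "(\<Sum>i=1..n. \<xi> i * ((\<Sum>j=1..n. \<eta> i j * C * lam j) - \<alpha> i)) =
      (\<Sum>i=1..n. \<xi> i * (\<Sum>j=1..n. \<eta> i j * C * lam j)) - (\<Sum>i=1..n. \<alpha> i * \<xi> i)"
    by (simp add: right_diff_distrib sum_subtractf mult.commute)
  moreover have "(\<Sum>i=1..n. \<alpha> i * (y i * (w \<bullet> \<phi> (x i) + b) - 1 + \<xi> i)) =
      w \<bullet> ?W + b * (\<Sum>i=1..n. \<alpha> i * y i) - (\<Sum>i=1..n. \<alpha> i) + (\<Sum>i=1..n. \<alpha> i * \<xi> i)"
    by (simp add: inner_dual_weight sum_distrib_left ring_distribs sum.distrib sum_subtractf mult_ac)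
  moreover have "(\<Sum>i=1..n. \<alpha> i * y i) = 0"
    using feas by (simp add: dual_feasible_def)
  moreover have "(norm (w - ?W))\<^sup>2 = (norm w)\<^sup>2 - 2 * (w \<bullet> ?W) + ?W \<bullet> ?W"
    by (simp add: power2_norm_eq_inner inner_diff inner_commute)
  ultimately show ?thesis
    unfolding dual_objective_eq[OF K] primal_objective_def by (simp add: field_simps)
qed

section \<open>Optimality of the dual solution\<close>

text \<open>
  The exact second-order expansion of the dual objective; the coefficient of \<open>t\<close> is the
  gradient at \<open>\<alpha>\<close>, applied to the direction \<open>\<delta>\<close>.
\<close>

lemma dual_objective_step:
  assumes K: "\<forall>z z'. K z z' = \<phi> z \<bullet> \<phi> z'"
  shows "dual_objective n x y K (\<lambda>i. \<alpha> i + t * \<delta> i) = dual_objective n x y K \<alpha>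
    + t * (\<Sum>i=1..n. (1 - y i * (dual_weight n x y \<phi> \<alpha> \<bullet> \<phi> (x i))) * \<delta> i)
    - t\<^sup>2 / 2 * (norm (dual_weight n x y \<phi> \<delta>))\<^sup>2"
proof -
  let ?W = "dual_weight n x y \<phi>"
  have W: "?W (\<lambda>i. \<alpha> i + t * \<delta> i) = ?W \<alpha> + t *\<^sub>R ?W \<delta>"
    by (simp add: dual_weight_def scaleR_sum_right ring_distribs scaleR_add_left sum.distrib mult_ac)
  have lin: "(\<Sum>i=1..n. (1 - y i * (?W \<alpha> \<bullet> \<phi> (x i))) * \<delta> i) = (\<Sum>i=1..n. \<delta> i) - ?W \<alpha> \<bullet> ?W \<delta>"
    unfolding inner_dual_weight[of "?W \<alpha>"]
    by (simp add: left_diff_distrib right_diff_distrib sum_subtractf mult_ac)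
  have "(\<Sum>i=1..n. \<alpha> i + t * \<delta> i) = (\<Sum>i=1..n. \<alpha> i) + t * (\<Sum>i=1..n. \<delta> i)"
    by (simp add: sum.distrib sum_distrib_left)
  moreover have "(?W \<alpha> + t *\<^sub>R ?W \<delta>) \<bullet> (?W \<alpha> + t *\<^sub>R ?W \<delta>)
      = ?W \<alpha> \<bullet> ?W \<alpha> + 2 * t * (?W \<alpha> \<bullet> ?W \<delta>) + t\<^sup>2 * (?W \<delta> \<bullet> ?W \<delta>)"
    by (simp add: inner_add inner_commute power2_eq_square)
  ultimately show ?thesis
    unfolding dual_objective_eq[OF K] W lin power2_norm_eq_inner by (simp add: algebra_simps)
qed

lemma dual_feasible_convex:
  assumes a: "dual_feasible n y C lam \<alpha> \<eta>" and b: "dual_feasible n y C lam \<alpha>' \<eta>'"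
    and t: "0 \<le> t" "t \<le> 1"
  shows "dual_feasible n y C lam (\<lambda>i. \<alpha> i + t * (\<alpha>' i - \<alpha> i)) (\<lambda>i j. \<eta> i j + t * (\<eta>' i j - \<eta> i j))"
proof -
  have mix: "p + t * (q - p) = (1 - t) * p + t * q" for p q :: real
    by (simp add: algebra_simps)
  have 1: "(\<Sum>i=1..n. ((1 - t) * \<alpha> i + t * \<alpha>' i) * y i) =
      (1 - t) * (\<Sum>i=1..n. \<alpha> i * y i) + t * (\<Sum>i=1..n. \<alpha>' i * y i)"
    by (simp add: sum_distrib_left sum.distrib ring_distribs mult_ac)
  have 2: "(\<Sum>j=1..n. ((1 - t) * \<eta> i j + t * \<eta>' i j) * C * lam j) =
      (1 - t) * (\<Sum>j=1..n. \<eta> i j * C * lam j) + t * (\<Sum>j=1..n. \<eta>' i j * C * lam j)" for i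
    by (simp add: sum_distrib_left sum.distrib distrib_right mult.assoc)
  show ?thesis
    using a b t unfolding dual_feasible_def mix 1 2
    by (auto intro!: add_mono mult_left_mono simp: sum.distrib simp flip: sum_distrib_left)
qed

text \<open>
  If the linearization were larger at \<open>\<alpha>'\<close> than at \<open>\<alpha>\<close>, then a short step from \<open>\<alpha>\<close> towards
  \<open>\<alpha>'\<close>, which stays in the convex feasible region, would increase the quadratic objective,
  because the loss is only of second order in the step length.
\<close>

lemma dual_optimal_linearized:
  assumes K: "\<forall>z z'. K z z' = \<phi> z \<bullet> \<phi> z'"
    and opt: "dual_optimal n x y C lam K \<alpha> \<eta>"
    and feas': "dual_feasible n y C lam \<alpha>' \<eta>'"
  shows "(\<Sum>i=1..n. (1 - y i * (dual_weight n x y \<phi> \<alpha> \<bullet> \<phi> (x i))) * \<alpha>' i) \<le>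
    (\<Sum>i=1..n. (1 - y i * (dual_weight n x y \<phi> \<alpha> \<bullet> \<phi> (x i))) * \<alpha> i)" (is "?g \<alpha>' \<le> ?g \<alpha>")
proof (rule ccontr)
  let ?\<delta> = "\<lambda>i. \<alpha>' i - \<alpha> i"
  define L where "L = ?g ?\<delta>"
  define Q where "Q = (norm (dual_weight n x y \<phi> ?\<delta>))\<^sup>2"
  assume "\<not> ?thesis"
  then have L: "L > 0" by (simp add: L_def right_diff_distrib sum_subtractf)
  have Q: "Q \<ge> 0" by (simp add: Q_def)
  \<comment> \<open>A step of length \<open>t\<close> gains \<open>t * L - t\<^sup>2 / 2 * Q\<close>, which is positive as soon as \<open>t * Q < 2 * L\<close>;
      the summand 1 only guards against \<open>Q = 0\<close>.\<close>
  define t where "t = min 1 (L / (Q + 1))"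
  have t: "0 < t" "t \<le> 1" using L Q by (auto simp: t_def)
  have "dual_feasible n y C lam \<alpha> \<eta>"
    using opt by (simp add: dual_optimal_def is_arg_max_def)
  then have "dual_feasible n y C lam (\<lambda>i. \<alpha> i + t * ?\<delta> i) (\<lambda>i j. \<eta> i j + t * (\<eta>' i j - \<eta> i j))"
    using feas' t by (intro dual_feasible_convex) auto
  then have "\<not> dual_objective n x y K (\<lambda>i. \<alpha> i + t * ?\<delta> i) > dual_objective n x y K \<alpha>"
    using opt by (auto simp: dual_optimal_def is_arg_max_def)
  then have "t * L \<le> t * (t * Q / 2)"
    unfolding dual_objective_step[OF K] by (simp add: L_def Q_def power2_eq_square)
  then have "L \<le> t * Q / 2" using t(1) by simp
  moreover have "t * (Q + 1) \<le> L"
    using Q pos_le_divide_eq[of "Q + 1" t L] by (simp add: t_def)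
  ultimately show False using L t Q by (simp add: algebra_simps)
qed

text \<open>
  The multipliers of the linearized dual are the primal variables: \<open>\<xi> i\<close> belongs to the upper
  bound on \<open>\<alpha> i\<close>, \<open>u i\<close> and \<open>v j\<close> to the row and column sums of \<open>\<eta>\<close>, and \<open>b\<close> to the balance
  equation. The multipliers \<open>\<sigma>\<close> and \<open>\<rho>\<close> of the sign constraints on \<open>\<alpha>\<close> and \<open>\<eta>\<close> turn out to be
  the slacks of the primal constraints, so their nonnegativity is primal feasibility.
\<close>

lemma strong_duality:
  assumes K: "\<forall>z z'. K z z' = \<phi> z \<bullet> \<phi> z'"
    and opt: "dual_optimal n x y C lam K \<alpha> \<eta>"
  obtains w b \<xi> u v where "primal_feasible n x y C lam \<phi> w b \<xi> u v"
    "primal_objective n w u v = dual_objective n x y K \<alpha>"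
proof -
  let ?N = "{1..n}"
  define W where "W = dual_weight n x y \<phi> \<alpha>"
  have feas: "dual_feasible n y C lam \<alpha> \<eta>"
    using opt by (simp add: dual_optimal_def is_arg_max_def)
  \<comment> \<open>The pair \<open>(\<alpha>, \<eta>)\<close> is one point: \<open>Inl i\<close> indexes \<open>\<alpha> i\<close>, \<open>Inr (i, j)\<close> indexes \<open>\<eta> i j\<close>. The inequalities
      \<open>f\<close> are the upper bounds, the signs of \<open>\<alpha>\<close> and the signs of \<open>\<eta>\<close>; the equations \<open>h\<close> are the
      row sums, the column sums and the balance equation.\<close>
  define z :: "nat + nat \<times> nat \<Rightarrow> real" where "z = case_sum \<alpha> (\<lambda>(i, j). \<eta> i j)"
  define g :: "(nat + nat \<times> nat \<Rightarrow> real) \<Rightarrow> real" where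
    "g s = (\<Sum>i=1..n. (1 - y i * (W \<bullet> \<phi> (x i))) * s (Inl i))" for s
  define f :: "nat + nat + nat \<times> nat \<Rightarrow> (nat + nat \<times> nat \<Rightarrow> real) \<Rightarrow> real" where
    "f = case_sum (\<lambda>i s. s (Inl i) - (\<Sum>j=1..n. s (Inr (i, j)) * C * lam j))
        (case_sum (\<lambda>i s. - s (Inl i)) (\<lambda>p s. - s (Inr p)))"
  define h :: "nat + nat + unit \<Rightarrow> (nat + nat \<times> nat \<Rightarrow> real) \<Rightarrow> real" where
    "h = case_sum (\<lambda>i s. \<Sum>j=1..n. s (Inr (i, j)))
        (case_sum (\<lambda>j s. \<Sum>i=1..n. s (Inr (i, j))) (\<lambda>_ s. \<Sum>i=1..n. s (Inl i) * y i))"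
  define \<gamma> :: "nat + nat + unit \<Rightarrow> real" where
    "\<gamma> = case_sum (\<lambda>_. 1) (case_sum (\<lambda>_. 1) (\<lambda>_. 0))"
  let ?I = "?N <+> (?N <+> ?N \<times> ?N)" and ?E = "?N <+> (?N <+> {()})"
  have polytope: "((\<forall>i\<in>?I. f i s \<le> 0) \<and> (\<forall>e\<in>?E. h e s = \<gamma> e)) \<longleftrightarrow>
      dual_feasible n y C lam (\<lambda>i. s (Inl i)) (\<lambda>i j. s (Inr (i, j)))" for s
    unfolding dual_feasible_def f_def h_def \<gamma>_def by (auto simp: Plus_def ball_Un)
  have z_feas: "(\<forall>i\<in>?I. f i z \<le> 0) \<and> (\<forall>e\<in>?E. h e z = \<gamma> e)"
    unfolding polytope using feas by (simp add: z_def)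
  obtain c d where c0: "\<And>i. i \<in> ?I \<Longrightarrow> 0 \<le> c i"
    and cs: "\<And>i. i \<in> ?I \<Longrightarrow> c i * (0 - f i z) = 0"
    and g: "\<And>s. g s = (\<Sum>i\<in>?I. c i * f i s) + (\<Sum>e\<in>?E. d e * h e s)"
  proof (rule linear_program_multipliers[where I = ?I and E = ?E and f = f and h = h and g = g
        and z = z and \<beta> = "\<lambda>_. 0" and \<gamma> = \<gamma>])
    show "linear_form (f i)" if "i \<in> ?I" for i
      by (auto simp: f_def linear_form_def sum.distrib sum_distrib_left algebra_simps split: sum.split)
    show "linear_form (h e)" if "e \<in> ?E" for e
      by (auto simp: h_def linear_form_def sum.distrib sum_distrib_left algebra_simps split: sum.split)
    show "linear_form g"
      by (simp add: g_def linear_form_def distrib_left sum.distrib sum_distrib_left mult.left_commute)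
    fix s assume "\<And>i. i \<in> ?I \<Longrightarrow> f i s \<le> 0" "\<And>e. e \<in> ?E \<Longrightarrow> h e s = \<gamma> e"
    then have "dual_feasible n y C lam (\<lambda>i. s (Inl i)) (\<lambda>i j. s (Inr (i, j)))"
      using polytope by blast
    then show "g s \<le> g z"
      using dual_optimal_linearized[OF K opt] by (simp add: g_def z_def W_def)
  qed (use z_feas in auto)
  define \<xi> where "\<xi> i = c (Inl i)" for i
  define \<sigma> where "\<sigma> i = c (Inr (Inl i))" for i
  define \<rho> where "\<rho> i j = c (Inr (Inr (i, j)))" for i j
  define u where "u i = d (Inl i)" for i
  define v where "v j = d (Inr (Inl j))" for j
  define b where "b = d (Inr (Inr ()))"
  have g_expand: "g s = (\<Sum>i=1..n. \<xi> i * (s (Inl i) - (\<Sum>j=1..n. s (Inr (i, j)) * C * lam j)))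
      - (\<Sum>i=1..n. \<sigma> i * s (Inl i)) - (\<Sum>i=1..n. \<Sum>j=1..n. \<rho> i j * s (Inr (i, j)))
      + (\<Sum>i=1..n. u i * (\<Sum>j=1..n. s (Inr (i, j))))
      + (\<Sum>j=1..n. v j * (\<Sum>i=1..n. s (Inr (i, j))))
      + b * (\<Sum>i=1..n. s (Inl i) * y i)" for s
    unfolding g by (simp add: sum.Plus f_def h_def \<xi>_def \<sigma>_def \<rho>_def u_def v_def b_def
        sum_negf sum.cartesian_product split_def)
  \<comment> \<open>Evaluation at the unit vectors compares the coefficients of \<open>\<alpha> m\<close>, and below those of \<open>\<eta> p q\<close>.\<close>
  have margin: "y m * (W \<bullet> \<phi> (x m) + b) - 1 + \<xi> m = \<sigma> m" if "m \<in> ?N" for m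
    using that g_expand[of "\<lambda>a. if a = Inl m then 1 else 0"]
    by (simp add: g_def if_distrib[of "\<lambda>a. a * _"] if_distrib[of "\<lambda>a. _ * a"] cong: if_cong)
      (simp add: algebra_simps)
  have cost: "u p + v q - C * lam q * \<xi> p = \<rho> p q" if pq: "p \<in> ?N" "q \<in> ?N" for p q
  proof -
    define e :: "nat \<Rightarrow> nat \<Rightarrow> real" where "e i j = (if i = p \<and> j = q then 1 else 0)" for i j
    have row: "(\<Sum>j=1..n. e i j * a j) = (if i = p then a q else 0)" for a i
      using pq by (cases "i = p") (simp_all add: e_def if_distrib[of "\<lambda>a. a * _"] cong: if_cong)
    have col: "(\<Sum>i=1..n. e i j) = (if j = q then 1 else 0)" for j
      using pq by (cases "j = q") (simp_all add: e_def)
    have "0 = (\<Sum>i=1..n. \<xi> i * (0 - (\<Sum>j=1..n. e i j * (C * lam j))))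
        - (\<Sum>i=1..n. \<Sum>j=1..n. e i j * \<rho> i j)
        + (\<Sum>i=1..n. u i * (\<Sum>j=1..n. e i j * 1)) + (\<Sum>j=1..n. v j * (\<Sum>i=1..n. e i j))"
      using g_expand[of "case_sum (\<lambda>_. 0) (\<lambda>(i, j). e i j)"] by (simp add: g_def mult_ac)
    also have "\<dots> = - (\<xi> p * (C * lam q)) - \<rho> p q + u p + v q"
      unfolding row col using pq
      by (simp add: if_distrib[of uminus] if_distrib[of "\<lambda>a. _ * a"] cong: if_cong)
    finally show ?thesis by (simp add: mult_ac)
  qed
  have \<xi>: "0 \<le> \<xi> i" "\<xi> i * ((\<Sum>j=1..n. \<eta> i j * C * lam j) - \<alpha> i) = 0" if "i \<in> ?N" for i
    using c0[OF InlI[OF that]] cs[OF InlI[OF that]] by (auto simp: \<xi>_def f_def z_def)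
  have \<sigma>: "0 \<le> \<sigma> i" "\<alpha> i * \<sigma> i = 0" if "i \<in> ?N" for i
    using c0[OF InrI[OF InlI[OF that]]] cs[OF InrI[OF InlI[OF that]]] by (auto simp: \<sigma>_def f_def z_def)
  have \<rho>: "0 \<le> \<rho> i j" "\<eta> i j * \<rho> i j = 0" if "i \<in> ?N" "j \<in> ?N" for i j
    using c0[OF InrI[OF InrI[OF SigmaI[OF that]]]] cs[OF InrI[OF InrI[OF SigmaI[OF that]]]]
    by (auto simp: \<rho>_def f_def z_def)
  show ?thesis
  proof (rule that[of W b \<xi> u v])
    have "0 \<le> y i * (W \<bullet> \<phi> (x i) + b) - 1 + \<xi> i" if "i \<in> ?N" for i
      using margin \<sigma>(1) that by simp
    moreover have "0 \<le> u i + v j - C * lam j * \<xi> i" if "i \<in> ?N" "j \<in> ?N" for i j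
      using cost \<rho>(1) that by simp
    ultimately show "primal_feasible n x y C lam \<phi> W b \<xi> u v"
      unfolding primal_feasible_def using \<xi>(1) by (fastforce simp: algebra_simps)
    have "(\<Sum>i=1..n. \<alpha> i * (y i * (W \<bullet> \<phi> (x i) + b) - 1 + \<xi> i)) = 0"
      using margin \<sigma>(2) by (intro sum.neutral) simp
    moreover have "(\<Sum>i=1..n. \<xi> i * ((\<Sum>j=1..n. \<eta> i j * C * lam j) - \<alpha> i)) = 0"
      using \<xi>(2) by (intro sum.neutral) blast
    moreover have "(\<Sum>i=1..n. \<Sum>j=1..n. \<eta> i j * (u i + v j - C * lam j * \<xi> i)) = 0"
      using cost \<rho>(2) by (intro sum.neutral ballI) simp
    ultimately show "primal_objective n W u v = dual_objective n x y K \<alpha>"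
      using duality_gap[OF K feas, where w = W and x = x and b = b and \<xi> = \<xi> and u = u and v = v]
      by (simp add: W_def)
  qed
qed

text \<open>
  Feasibility makes every summand of the duality gap nonnegative, so a gap that is not positive
  forces each of them to vanish.
\<close>

lemma complementary_slackness:
  assumes K: "\<forall>z z'. K z z' = \<phi> z \<bullet> \<phi> z'"
    and dual: "dual_feasible n y C lam \<alpha> \<eta>"
    and primal: "primal_feasible n x y C lam \<phi> w b \<xi> u v"
    and le: "primal_objective n w u v \<le> dual_objective n x y K \<alpha>"
  shows "w = dual_weight n x y \<phi> \<alpha>"
    and "i \<in> {1..n} \<Longrightarrow> \<alpha> i * (y i * (w \<bullet> \<phi> (x i) + b) - 1 + \<xi> i) = 0"
    and "i \<in> {1..n} \<Longrightarrow> \<xi> i * ((\<Sum>j=1..n. \<eta> i j * C * lam j) - \<alpha> i) = 0"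
proof -
  let ?A = "\<lambda>i. \<alpha> i * (y i * (w \<bullet> \<phi> (x i) + b) - 1 + \<xi> i)"
  let ?B = "\<lambda>i. \<xi> i * ((\<Sum>j=1..n. \<eta> i j * C * lam j) - \<alpha> i)"
  let ?D = "\<lambda>i j. \<eta> i j * (u i + v j - C * lam j * \<xi> i)"
  have A: "0 \<le> ?A i" if i: "i \<in> {1..n}" for i
  proof -
    have "1 - \<xi> i \<le> y i * (w \<bullet> \<phi> (x i) + b)" "0 \<le> \<alpha> i"
      using dual primal i by (auto simp: dual_feasible_def primal_feasible_def)
    then show ?thesis by (intro mult_nonneg_nonneg) auto
  qed
  have B: "0 \<le> ?B i" if "i \<in> {1..n}" for i
    using dual primal that by (auto simp: dual_feasible_def primal_feasible_def)
  have D: "0 \<le> ?D i j" if "i \<in> {1..n}" "j \<in> {1..n}" for i j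
    using dual primal that by (auto simp: dual_feasible_def primal_feasible_def)
  have sums: "0 \<le> sum ?A {1..n}" "0 \<le> sum ?B {1..n}" "0 \<le> (\<Sum>i=1..n. \<Sum>j=1..n. ?D i j)"
    using A B D by (auto intro!: sum_nonneg)
  have gap: "1/2 * (norm (w - dual_weight n x y \<phi> \<alpha>))\<^sup>2 + sum ?A {1..n} + sum ?B {1..n}
      + (\<Sum>i=1..n. \<Sum>j=1..n. ?D i j) \<le> 0"
    using duality_gap[OF K dual, where w = w and x = x and b = b and \<xi> = \<xi> and u = u and v = v] le
    by simp
  have sq: "0 \<le> (norm (w - dual_weight n x y \<phi> \<alpha>))\<^sup>2" by simp
  have "(norm (w - dual_weight n x y \<phi> \<alpha>))\<^sup>2 = 0" "sum ?A {1..n} = 0" "sum ?B {1..n} = 0"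
    using gap sums sq by linarith+
  then show "w = dual_weight n x y \<phi> \<alpha>" "i \<in> {1..n} \<Longrightarrow> ?A i = 0" "i \<in> {1..n} \<Longrightarrow> ?B i = 0"
    using sum_nonneg_eq_0_iff[of "{1..n}" ?A] sum_nonneg_eq_0_iff[of "{1..n}" ?B] A B
    by auto
qed

section \<open>The coefficient of the separator function\<close>

theorem proposition3p2:
  fixes n k :: nat
    and x :: "nat \<Rightarrow> real ^ 'd"
    and y lam :: "nat \<Rightarrow> real"
    and C b :: real
    and \<phi> :: "real ^ 'd \<Rightarrow> 'h::real_inner"
    and K :: "real ^ 'd \<Rightarrow> real ^ 'd \<Rightarrow> real"
    and \<alpha> :: "nat \<Rightarrow> real"
    and \<eta> :: "nat \<Rightarrow> nat \<Rightarrow> real"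
    and f :: "real ^ 'd \<Rightarrow> real"
  assumes "\<forall>i\<in>{1..n}. y i \<in> {-1, 1}"
    and "C > 0"
    and "\<forall>i\<in>{1..n}. 0 \<le> lam i"
    and "mono_on {1..n} lam"
    and "\<forall>z z'. K z z' = \<phi> z \<bullet> \<phi> z'"
    and "dual_optimal n x y C lam K \<alpha> \<eta>"
    and "k \<in> {1..n}"
    and "0 < \<alpha> k"
    and "\<alpha> k < C * (\<Sum>j=1..n. \<eta> k j * lam j)"
    and "separator_function n x y C lam \<phi> K \<alpha> f b"
  shows "b = (1 - y k * (\<Sum>i=1..n. \<alpha> i * y i * K (x i) (x k))) / y k"
proof -
  have dual: "dual_feasible n y C lam \<alpha> \<eta>"
    using assms(6) by (simp add: dual_optimal_def is_arg_max_def)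
  obtain w \<xi> u v where opt: "primal_optimal n x y C lam \<phi> w b \<xi> u v"
    using assms(10) by (auto simp: separator_function_def)
  then have primal: "primal_feasible n x y C lam \<phi> w b \<xi> u v"
    by (simp add: primal_optimal_def is_arg_min_def)
  obtain w' b' \<xi>' u' v' where feas': "primal_feasible n x y C lam \<phi> w' b' \<xi>' u' v'"
    and value': "primal_objective n w' u' v' = dual_objective n x y K \<alpha>"
    using strong_duality[OF assms(5,6)] .
  \<comment> \<open>The given primal solution need not be the point found by strong duality, but it is no worse.\<close>
  have "\<not> primal_objective n w' u' v' < primal_objective n w u v"
    using opt feas' by (auto simp: primal_optimal_def is_arg_min_def)
  then have le: "primal_objective n w u v \<le> dual_objective n x y K \<alpha>"
    using value' by simp
  note slack = complementary_slackness[OF assms(5) dual primal le]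
  have "(\<Sum>j=1..n. \<eta> k j * C * lam j) - \<alpha> k \<noteq> 0"
    using assms(9) by (simp add: sum_distrib_left mult_ac)
  then have "\<xi> k = 0" using slack(3)[OF assms(7)] by simp
  then have margin: "y k * (w \<bullet> \<phi> (x k) + b) = 1"
    using slack(2)[OF assms(7)] assms(8) by simp
  have "w \<bullet> \<phi> (x k) = (\<Sum>i=1..n. \<alpha> i * y i * K (x i) (x k))"
    by (simp add: slack(1) dual_weight_def inner_sum_left assms(5))
  moreover have "y k \<noteq> 0" using assms(1,7) by fastforce
  ultimately show ?thesis using margin by (simp add: field_simps)
qed

end
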